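(* Let $k\in\mathbb{N}$ with $k\geq 4$ and let $n\in\mathbb{N}$ with \[ (k-1)\pi(\sqrt[3]{n^2})-(2k-1)\pi(\sqrt{n})>k^2-k. \] Then there exists some $A\in CS_k^{max}(n)$ of the form \[ A=\{1\}\cup\mathbb{P}(\sqrt[3]{n},n)\cup\{p^2:p\in\mathbb{P}(\sqrt[3]{n},\sqrt{n})\}\cup X\cup Y\cup Z, \] where \begin{itemize} \item $o_p(X)=k$ holds for all $p\in\mathbb{P}(1,\sqrt[3]{n})$, \item every element of $X$ is of the form $pq$ with $p\in\mathbb{P}(1,\sqrt[3]{n})$ and $q\in\mathbb{P}(\sqrt{n},n)$, \item every element of $Y$ is of the form $pq$ with $p\in\mathbb{P}(\sqrt[3]{n},\sqrt{n})$ and $q\in\mathbb{P}(\sqrt{n},n)$, \item every element of $Z$ is a product of two distinct elements of $\mathbb{P}(\sqrt[3]{n},\sqrt{n})$. \end{itemize}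
   Context: $\mathbb{N}$ is the set of positive integers, $\mathbb{P}$ the set of primes, $[n]:=\{1,2,\dots,n\}$, $\mathbb{P}(x,y):=\mathbb{P}\cap(x,y]$ for real $x,y$, and $\pi(x)$ is the number of primes $\leq x$. For a finite set $A\subseteq\mathbb{N}$ and a prime $p$, $o_p(A):=|A\cap p\mathbb{N}|$ is the number of elements of $A$ divisible by $p$. For positive integers $k,n$ define $CS_k(n):=\{A\subseteq[n]: o_p(A)\leq k\text{ for all }p\in\mathbb{P}\}$, and let $CS_k^{max}(n)$ be the set of elements of $CS_k(n)$ of maximal cardinality. *)

theory Defs
  imports Complex_Main "HOL-Computational_Algebra.Primes"
begin

definition primes_between :: "real \<Rightarrow> real \<Rightarrow> nat set" where
  "primes_between x y = {p. prime p \<and> x < real p \<and> real p \<le> y}"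

definition prime_pi :: "real \<Rightarrow> nat" where
  "prime_pi x = card {p::nat. prime p \<and> real p \<le> x}"

text \<open>
  Meant for finite sets \<open>A\<close> of positive integers, so it does not matter that
  \<open>0\<close> counts as a multiple of \<open>p\<close> here.
\<close>

definition occ :: "nat \<Rightarrow> nat set \<Rightarrow> nat" where
  "occ p A = card (A \<inter> {m. p dvd m})"

definition CS :: "nat \<Rightarrow> nat \<Rightarrow> nat set set" where
  "CS k n = {A. A \<subseteq> {1..n} \<and> (\<forall>p. prime p \<longrightarrow> occ p A \<le> k)}"

definition CS_max :: "nat \<Rightarrow> nat \<Rightarrow> nat set set" where
  "CS_max k n = {A \<in> CS k n. \<forall>B \<in> CS k n. card B \<le> card A}"

end

theory Submission
  imports Defs
begin

text \<open>
  Call a prime small if \<open>p\<^sup>3 \<le> n\<close>. Start from any maximal \<open>A\<close>. If \<open>g\<close> is \<open>r\<close> or \<open>r\<^sup>2\<close> for a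
  non-small prime \<open>r\<close> and \<open>g \<notin> A\<close>, then by maximality \<open>r\<close> has \<open>k\<close> multiples in \<open>A\<close>, and one of them,
  different from \<open>r\<close> and \<open>r\<^sup>2\<close>, can be traded for \<open>g\<close>; so \<open>A\<close> may be assumed to contain all these
  numbers. Now discard the at most \<open>k\<close> multiples of each small prime and refill greedily with
  products \<open>p * q\<close>, where \<open>p\<close> is small and \<open>\<surd>n < q \<le> n\<^bsup>2/3\<^esup>\<close>. The process cannot stop early: otherwise
  all but \<open>k - 1\<close> of these \<open>q\<close> have \<open>k - 1\<close> proper multiples in the set, each of which is also a
  multiple of a prime \<open>\<le> \<surd>n\<close>, so that \<open>k \<pi>(\<surd>n)\<close> bounds their number, against the
  hypothesis. What remains of the old set has no small prime factor, hence at most two prime factors.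
\<close>

section \<open>The prescribed elements and basic facts on occurrence counts\<close>

text \<open>The elements of the sought set that are fixed in advance. Comparing powers replaces real
  roots: \<open>n < p ^ 3\<close> says that \<open>p\<close> exceeds the cube root of
  \<open>n\<close>.\<close>

definition core :: "nat \<Rightarrow> nat set" where
  "core n = {1} \<union> {p. prime p \<and> n < p ^ 3 \<and> p \<le> n} \<union> {p\<^sup>2 | p. prime p \<and> n < p ^ 3 \<and> p\<^sup>2 \<le> n}"

lemma CS_subset: "A \<in> CS k n \<Longrightarrow> A \<subseteq> {1..n}"
  by (simp add: CS_def)

lemma CS_occ: "A \<in> CS k n \<Longrightarrow> prime p \<Longrightarrow> occ p A \<le> k"
  by (simp add: CS_def)

lemma CS_finite: "A \<in> CS k n \<Longrightarrow> finite A"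
  by (rule finite_subset[OF CS_subset]) simp_all

lemma occ_mono: "finite B \<Longrightarrow> A \<subseteq> B \<Longrightarrow> occ p A \<le> occ p B"
  unfolding occ_def by (intro card_mono) auto

lemma occ_insert:
  assumes "finite A" "x \<notin> A"
  shows "occ p (insert x A) = (if p dvd x then Suc (occ p A) else occ p A)"
  using assms by (simp add: occ_def Int_insert_left)

lemma occ_remove:
  assumes "finite A" "a \<in> A" "p dvd a"
  shows "Suc (occ p (A - {a})) = occ p A"
  using occ_insert[of "A - {a}" a p] assms by (simp add: insert_absorb)

lemma CS_mono:
  assumes "B \<in> CS k n" "A \<subseteq> B"
  shows "A \<in> CS k n"
proof -
  have "occ p A \<le> k" if "prime p" for p
    using occ_mono[OF CS_finite[OF assms(1)] assms(2)] CS_occ[OF assms(1) that] by (rule order_trans)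
  then show ?thesis using CS_subset[OF assms(1)] assms(2) by (auto simp: CS_def)
qed

lemma CS_insert:
  assumes "A \<in> CS k n" "1 \<le> x" "x \<le> n" "\<And>p. prime p \<Longrightarrow> p dvd x \<Longrightarrow> occ p A < k"
  shows "insert x A \<in> CS k n"
proof (cases "x \<in> A")
  case False
  then show ?thesis
    using assms CS_finite[OF assms(1)] by (auto simp: CS_def occ_insert Suc_le_eq)
qed (use assms in \<open>simp add: insert_absorb\<close>)

lemma CS_max_nonempty: "CS_max k n \<noteq> {}"
proof -
  have "finite (CS k n)"
    by (rule finite_subset[of _ "Pow {1..n}"]) (auto simp: CS_def)
  moreover have "{} \<in> CS k n"
    by (simp add: CS_def occ_def)
  ultimately obtain A where "A \<in> CS k n" "Max (card ` CS k n) = card A"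
    using Max_in[of "card ` CS k n"] by blast
  then have "A \<in> CS k n" "\<forall>B\<in>CS k n. card B \<le> card A"
    using \<open>finite (CS k n)\<close> by (metis Max_ge finite_imageI imageI)+
  then show ?thesis
    by (auto simp: CS_max_def)
qed

section \<open>Exchange argument: a maximal set containing the prescribed elements\<close>

lemma core_subset: "n \<ge> 1 \<Longrightarrow> core n \<subseteq> {1..n}"
  by (auto simp: core_def Suc_le_eq prime_gt_0_nat)

text \<open>An element other than 1 is a power of one prime, so inserting it raises the count of
  that prime only. This is what makes a one-for-one exchange possible.\<close>

lemma core_dvd:
  assumes "g \<in> core n" "prime p" "p dvd g"
  shows "n < p ^ 3" "g = p \<or> g = p\<^sup>2"
proof -
  have "g \<noteq> 1" using assms by auto
  then obtain r where r: "prime r" "n < r ^ 3" "g = r \<or> g = r\<^sup>2"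
    using assms(1) by (auto simp: core_def)
  then have "p dvd r" using assms by (auto dest: prime_dvd_power)
  then have "p = r" using assms(2) r(1) primes_dvd_imp_eq by blast
  then show "n < p ^ 3" "g = p \<or> g = p\<^sup>2" using r by auto
qed

lemma ex_CS_max_core:
  assumes "k \<ge> 2" "n \<ge> 1"
  shows "\<exists>A \<in> CS_max k n. core n \<subseteq> A"
proof -
  have fin: "finite (core n)"
    using core_subset[OF assms(2)] finite_subset by blast
  \<comment> \<open>Among the maximal sets, take one missing the fewest elements of
    \<open>core n\<close>; an exchange that gains such an element and loses none contradicts this
    choice.\<close>
  obtain A where A: "A \<in> CS_max k n" "\<And>B. B \<in> CS_max k n \<Longrightarrow> card (core n - A) \<le> card (core n - B)"
    using ex_has_least_nat[of "\<lambda>A. A \<in> CS_max k n" _ "\<lambda>A. card (core n - A)"] CS_max_nonempty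
    by blast
  have ACS: "A \<in> CS k n" and max: "\<And>B. B \<in> CS k n \<Longrightarrow> card B \<le> card A"
    using A(1) by (auto simp: CS_max_def)
  have finA: "finite A" using CS_finite[OF ACS] .
  have "core n \<subseteq> A"
  proof (rule ccontr)
    assume "\<not> core n \<subseteq> A"
    then obtain g where g: "g \<in> core n" "g \<notin> A" by blast
    have gn: "1 \<le> g" "g \<le> n" using core_subset[OF assms(2)] g(1) by auto
    have "insert g A \<notin> CS k n"
      using max[of "insert g A"] g(2) finA by auto
    then obtain r where r: "prime r" "r dvd g" "k \<le> occ r A"
      using CS_insert[OF ACS gn] by (meson not_le)
    have only: "h = r \<or> h = r\<^sup>2" if "h \<in> core n" "r dvd h" for h
      using core_dvd(2)[OF that(1) r(1) that(2)] .
    define R where "R = A \<inter> {m. r dvd m}"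
    \<comment> \<open>As \<open>g\<close> is itself \<open>r\<close> or \<open>r^2\<close>, the
      inclusion would leave at most one multiple of \<open>r\<close> in \<open>A\<close>, but there
      are at least \<open>k\<close>, and \<open>k \<ge> 2\<close>.\<close>
    have "\<not> R \<subseteq> {r, r\<^sup>2} - {g}"
    proof
      assume "R \<subseteq> {r, r\<^sup>2} - {g}"
      then have "card R \<le> card ({r, r\<^sup>2} - {g})" by (intro card_mono) auto
      also have "\<dots> < card {r, r\<^sup>2}"
        by (rule card_Diff1_less) (use only[OF g(1) r(2)] in auto)
      also have "\<dots> \<le> 2" by (simp add: card_insert_if)
      finally show False using r(3) assms(1) by (simp add: R_def occ_def)
    qed
    then obtain a where a: "a \<in> A" "r dvd a" "a \<notin> core n"
      using only g(2) unfolding R_def by blast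
    define A' where "A' = insert g (A - {a})"
    have "A' \<in> CS k n"
      unfolding A'_def
    proof (rule CS_insert)
      show "A - {a} \<in> CS k n" using CS_mono[OF ACS] by blast
      fix p assume p: "prime p" "p dvd g"
      \<comment> \<open>Only the count of \<open>r\<close> grows when \<open>g\<close> is inserted,
        and removing \<open>a\<close> has freed a place for it.\<close>
      have "p = r"
        using only[OF g(1) r(2)] p r(1) primes_dvd_imp_eq prime_dvd_power by blast
      then show "occ p (A - {a}) < k"
        using occ_remove[OF finA a(1,2)] CS_occ[OF ACS r(1)] by simp
    qed (use gn in auto)
    moreover have "card A' = card A"
      using a g(2) card_Suc_Diff1[OF finA a(1)] finA by (simp add: A'_def)
    ultimately have "A' \<in> CS_max k n" using max by (auto simp: CS_max_def)
    then have "card (core n - A) \<le> card (core n - A')" using A(2) by blast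
    moreover have "card (core n - A') < card (core n - A)"
      by (rule psubset_card_mono) (use fin g a in \<open>auto simp: A'_def\<close>)
    ultimately show False by simp
  qed
  then show ?thesis using A(1) by blast
qed

section \<open>Sizes of products of primes\<close>

text \<open>Keeps the refill products inside \<open>{1..n}\<close>; the case \<open>p = 1\<close>
  also yields \<open>q \<le> n\<close>.\<close>

lemma mult_le_of_cubes:
  fixes p q n :: nat
  assumes "p ^ 3 \<le> n" "q ^ 3 \<le> n\<^sup>2"
  shows "p * q \<le> n"
proof -
  have "(p * q) ^ 3 \<le> n * n\<^sup>2"
    unfolding power_mult_distrib using assms by (intro mult_mono) auto
  then have "(p * q) ^ 3 \<le> n ^ 3" by (simp add: power3_eq_cube power2_eq_square)
  then show ?thesis by (rule power_le_imp_le_base[where n = 2, simplified]) simp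
qed

text \<open>Otherwise \<open>q * r\<close> would divide \<open>c\<close> while exceeding
  \<open>n\<close>. Hence distinct primes above the square root of \<open>n\<close> have disjoint
  sets of multiples in \<open>{1..n}\<close>.\<close>

lemma square_gt_imp_eq:
  fixes c q r n :: nat
  assumes "prime q" "prime r" "n < q\<^sup>2" "n < r\<^sup>2" "q dvd c" "r dvd c" "0 < c" "c \<le> n"
  shows "q = r"
proof (rule ccontr)
  assume "q \<noteq> r"
  then have "q * r dvd c"
    using assms by (intro divides_mult primes_coprime) auto
  then have "q * r \<le> n" using assms(7,8) dvd_imp_le[of "q * r" c] by linarith
  moreover have "n * n < q\<^sup>2 * r\<^sup>2" using assms by (intro mult_strict_mono) auto
  ultimately show False
    using mult_mono[of "q * r" n "q * r" n] by (simp add: power2_eq_square ac_simps)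
qed

text \<open>Three prime factors, each above the cube root of \<open>n\<close>, would multiply to
  more than \<open>n\<close>. With two distinct ones, the smaller has its square below their
  product.\<close>

lemma no_small_prime_factor_cases:
  fixes c n :: nat
  assumes "1 \<le> c" "c \<le> n" and big: "\<And>p. prime p \<Longrightarrow> p dvd c \<Longrightarrow> n < p ^ 3"
  obtains "c \<in> core n"
  | p q where "prime p" "prime q" "n < p ^ 3" "n < q ^ 3" "p < q" "p\<^sup>2 \<le> n" "q \<le> n" "c = p * q"
proof (cases "c = 1")
  case True
  then show ?thesis using that(1) by (simp add: core_def)
next
  case False
  then obtain p d where p: "prime p" "c = p * d"
    by (metis prime_factor_nat dvdE)
  show ?thesis
  proof (cases "d = 1")
    case True
    then show ?thesis using that(1) p assms by (auto simp: core_def)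
  next
    case False
    then obtain q e where q: "prime q" "d = q * e"
      by (metis prime_factor_nat dvdE)
    have "e = 1"
    proof (rule ccontr)
      assume "e \<noteq> 1"
      then obtain r where r: "prime r" "r dvd e"
        by (metis prime_factor_nat)
      have "p * q * r dvd c" using r p q by (simp add: mult.assoc)
      then have le: "p * q * r \<le> n" using assms(1,2) dvd_imp_le[of "p * q * r" c] by linarith
      have "n < p ^ 3" "n < q ^ 3" "n < r ^ 3"
        using big p q r by auto
      then have "n * n * n < p ^ 3 * q ^ 3 * r ^ 3"
        using p q by (intro mult_strict_mono) (auto simp: prime_gt_0_nat)
      also have "\<dots> = (p * q * r) ^ 3" by (simp add: power_mult_distrib)
      also have "\<dots> \<le> n ^ 3" using le by (rule power_mono) simp
      finally show False by (simp add: power3_eq_cube)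
    qed
    then have c: "c = p * q" using p q by simp
    have bigs: "n < p ^ 3" "n < q ^ 3" using big p q by auto
    have le: "p \<le> n" "q \<le> n"
      using assms(1,2) dvd_imp_le[of p c] dvd_imp_le[of q c] dvd_triv_left[of p q] dvd_triv_right[of q p]
      unfolding c by linarith+
    consider "p = q" | "p < q" | "q < p" by linarith
    then show ?thesis
    proof cases
      case 1
      then have "c = p\<^sup>2" using c by (simp add: power2_eq_square)
      then show ?thesis using that(1) p bigs assms by (auto simp: core_def)
    next
      case 2
      then have "p * p \<le> p * q" by simp
      then have "p\<^sup>2 \<le> n" using assms(2) unfolding c power2_eq_square by linarith
      then show ?thesis using that(2) p q bigs 2 le c by blast
    next
      case 3
      then have "q * q \<le> p * q" by simp
      then have "q\<^sup>2 \<le> n" using assms(2) unfolding c power2_eq_square by linarith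
      then show ?thesis using that(2)[of q p] p q bigs 3 le c by (simp add: mult.commute)
    qed
  qed
qed

section \<open>Counting multiples and refilling\<close>

lemma finite_prime_power_le: "0 < j \<Longrightarrow> finite {p::nat. prime p \<and> p ^ j \<le> n}"
proof (rule finite_subset)
  assume "0 < j"
  then show "{p::nat. prime p \<and> p ^ j \<le> n} \<subseteq> {..n}"
    by (auto intro: order_trans[OF self_le_power] dest: prime_ge_1_nat)
qed simp

text \<open>A union bound, used with the primes up to the square root of \<open>n\<close> to limit
  the refill obstruction, and with the small primes to limit what is discarded.\<close>

lemma card_small_multiples_le:
  assumes "A \<in> CS k n" "finite P" "\<And>p. p \<in> P \<Longrightarrow> prime p"
  shows "card {a \<in> A. \<exists>p\<in>P. p dvd a} \<le> k * card P"
proof -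
  have "{a \<in> A. \<exists>p\<in>P. p dvd a} = (\<Union>p\<in>P. A \<inter> {m. p dvd m})" by blast
  then have "card {a \<in> A. \<exists>p\<in>P. p dvd a} \<le> (\<Sum>p\<in>P. occ p A)"
    unfolding occ_def by (simp only: card_UN_le[OF assms(2)])
  also have "\<dots> \<le> (\<Sum>p\<in>P. k)"
    by (intro sum_mono CS_occ[OF assms(1)] assms(3))
  finally show ?thesis by (simp add: mult.commute)
qed

lemma ex_free_large_prime:
  assumes C: "C \<in> CS k n" and p: "prime p" "occ p C < k"
    and Q: "finite Q" "\<And>q. q \<in> Q \<Longrightarrow> prime q \<and> n < q\<^sup>2"
    and card: "k * card {p. prime p \<and> p\<^sup>2 \<le> n} + k * (k - 1) < (k - 1) * card Q"
  shows "\<exists>q\<in>Q. p * q \<notin> C \<and> occ q C < k"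
proof (rule ccontr)
  assume none: "\<not> ?thesis"
  have finC: "finite C" using CS_finite[OF C] .
  define Q' where "Q' = {q \<in> Q. p * q \<notin> C}"
  \<comment> \<open>The prime \<open>q\<close> is left out because it has no prime factor up to the
    square root of \<open>n\<close>; this costs one element, hence the factor \<open>k - 1\<close>
    below.\<close>
  define T where "T q = C \<inter> {m. q dvd m} - {q}" for q
  define P where "P = {p. prime p \<and> p\<^sup>2 \<le> n}"
  \<comment> \<open>Each \<open>q\<close> outside \<open>Q'\<close> provides its own multiple
    \<open>p * q\<close> of \<open>p\<close> in \<open>C\<close>, and there are at most
    \<open>k - 1\<close> of those.\<close>
  have inj: "inj_on ((*) p) (Q - Q')" using p(1) by (auto simp: inj_on_def)
  have "card (Q - Q') = card ((*) p ` (Q - Q'))" using card_image[OF inj] by simp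
  also have "\<dots> \<le> occ p C"
    unfolding occ_def by (rule card_mono) (use finC in \<open>auto simp: Q'_def\<close>)
  finally have "card (Q - Q') \<le> k - 1" using p(2) by simp
  moreover have "card Q = card Q' + card (Q - Q')"
    using Q(1) by (subst card_Un_disjoint[symmetric]) (auto simp: Q'_def intro: arg_cong[where f = card])
  ultimately have cQ: "card Q \<le> card Q' + (k - 1)" by simp
  have Tcard: "card (T q) \<ge> k - 1" if "q \<in> Q'" for q
  proof -
    have q: "k \<le> occ q C" using none that by (auto simp: Q'_def not_less)
    then show ?thesis
      unfolding T_def occ_def by (simp add: card_Diff_singleton_if) linarith
  qed
  have "(k - 1) * card Q' \<le> (\<Sum>q\<in>Q'. card (T q))"
    using sum_bounded_below[of Q' "k - 1" "\<lambda>q. card (T q)"] Tcard by (simp add: mult.commute)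
  also have "\<dots> = card (\<Union>q\<in>Q'. T q)"
  proof (rule card_UN_disjoint[symmetric])
    show "finite Q'" using Q(1) by (simp add: Q'_def)
    show "\<forall>q\<in>Q'. finite (T q)" using finC by (simp add: T_def)
    show "\<forall>q\<in>Q'. \<forall>r\<in>Q'. q \<noteq> r \<longrightarrow> T q \<inter> T r = {}"
    proof (intro ballI impI)
      fix q r assume qr: "q \<in> Q'" "r \<in> Q'" "q \<noteq> r"
      have "c \<notin> T r" if "c \<in> T q" for c
      proof
        assume "c \<in> T r"
        then have "q dvd c" "r dvd c" "0 < c" "c \<le> n" "q \<in> Q" "r \<in> Q"
          using that qr CS_subset[OF C] by (auto simp: T_def Q'_def)
        then show False using square_gt_imp_eq[of q r n c] Q(2) qr(3) by blast
      qed
      then show "T q \<inter> T r = {}" by blast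
    qed
  qed
  also have "\<dots> \<le> card {a \<in> C. \<exists>p\<in>P. p dvd a}"
  proof (rule card_mono)
    show "(\<Union>q\<in>Q'. T q) \<subseteq> {a \<in> C. \<exists>p\<in>P. p dvd a}"
    proof
      fix c assume "c \<in> (\<Union>q\<in>Q'. T q)"
      then obtain q where q: "q \<in> Q" "c \<in> C" "q dvd c" "c \<noteq> q" by (auto simp: T_def Q'_def)
      then obtain j where j: "c = q * j" by blast
      have cn: "0 < c" "c \<le> n" using CS_subset[OF C] q(2) by auto
      obtain r where r: "prime r" "r dvd j"
        using j q(4) by (metis prime_factor_nat mult.right_neutral)
      have "q * r \<le> n"
        using cn dvd_imp_le[of "q * r" c] mult_dvd_mono[OF dvd_refl r(2), of q] unfolding j
        by linarith
      \<comment> \<open>The cofactor prime \<open>r\<close> satisfies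
        \<open>q * r \<le> n < q * q\<close>, so \<open>r < q\<close> and therefore
        \<open>r * r \<le> q * r \<le> n\<close>.\<close>
      moreover have "n < q * q" using Q(2)[OF q(1)] by (simp add: power2_eq_square)
      ultimately have "q * r < q * q" by linarith
      then have "r < q" by simp
      then have "r * r \<le> q * r" by simp
      then have "r * r \<le> n" using \<open>q * r \<le> n\<close> by (rule order_trans)
      then have "r \<in> P" using r(1) by (simp add: P_def power2_eq_square)
      then show "c \<in> {a \<in> C. \<exists>p\<in>P. p dvd a}"
        using q(2) dvd_mult[OF r(2), of q] unfolding j by blast
    qed
  qed (use finC in simp)
  also have "\<dots> \<le> k * card P"
    by (rule card_small_multiples_le[OF C]) (auto simp: P_def finite_prime_power_le)
  finally have "(k - 1) * card Q' \<le> k * card P" .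
  moreover have "(k - 1) * card Q \<le> (k - 1) * card Q' + (k - 1) * (k - 1)"
    using cQ by (metis add_mult_distrib2 mult_le_mono2)
  \<comment> \<open>Passes to the term \<open>k * (k - 1)\<close> of the hypothesis, which is the
    \<open>k^2 - k\<close> of the theorem.\<close>
  moreover have "(k - 1) * (k - 1) \<le> k * (k - 1)" by simp
  ultimately show False using card unfolding P_def by linarith
qed

lemma ex_refill:
  assumes B: "B \<in> CS k n"
    and nosmall: "\<And>b p. b \<in> B \<Longrightarrow> prime p \<Longrightarrow> p ^ 3 \<le> n \<Longrightarrow> \<not> p dvd b"
    and Q: "finite Q" "\<And>q. q \<in> Q \<Longrightarrow> prime q \<and> n < q\<^sup>2 \<and> q ^ 3 \<le> n\<^sup>2"
    and card: "k * card {p. prime p \<and> p\<^sup>2 \<le> n} + k * (k - 1) < (k - 1) * card Q"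
  obtains X where "B \<union> X \<in> CS k n" "B \<inter> X = {}"
    "\<And>x. x \<in> X \<Longrightarrow> \<exists>p q. prime p \<and> p ^ 3 \<le> n \<and> q \<in> Q \<and> x = p * q"
    "\<And>p. prime p \<Longrightarrow> p ^ 3 \<le> n \<Longrightarrow> occ p X = k"
proof -
  \<comment> \<open>The greedy process is replaced by a good \<open>X\<close> of largest
    cardinality; its size is bounded because it lies in \<open>{1..n}\<close>.\<close>
  define good where "good X \<longleftrightarrow> B \<union> X \<in> CS k n
    \<and> (\<forall>x\<in>X. \<exists>p q. prime p \<and> p ^ 3 \<le> n \<and> q \<in> Q \<and> x = p * q)" for X
  have bound: "card X < Suc (card {1..n})" if "good X" for X
    using card_mono[of "{1..n}" X] that CS_subset unfolding good_def less_Suc_eq_le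
    by (meson Un_subset_iff finite_atLeastAtMost)
  have "good {}" using B by (simp add: good_def)
  then obtain X where X: "good X" and max: "\<And>Y. good Y \<Longrightarrow> card Y \<le> card X"
    using ex_has_greatest_nat[of good "{}" card "Suc (card {1..n})"] bound by blast
  have C: "B \<union> X \<in> CS k n" using X by (simp add: good_def)
  have finX: "finite X" using CS_finite[OF C] by simp
  have full: "occ p X = k" if p: "prime p" "p ^ 3 \<le> n" for p
  proof (rule ccontr)
    assume "occ p X \<noteq> k"
    \<comment> \<open>No element of \<open>B\<close> is divisible by the small prime
      \<open>p\<close>, so \<open>X\<close> alone accounts for the count.\<close>
    have eq: "occ p (B \<union> X) = occ p X"
      unfolding occ_def by (rule arg_cong[where f = card]) (use nosmall p in blast)
    then have lt: "occ p (B \<union> X) < k" using \<open>occ p X \<noteq> k\<close> CS_occ[OF C p(1)] by simp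
    obtain q where q: "q \<in> Q" "p * q \<notin> B \<union> X" "occ q (B \<union> X) < k"
      using ex_free_large_prime[OF C p(1) lt Q(1) _ card] Q(2) by blast
    have pos: "1 \<le> p * q" using p q(1) Q(2) prime_gt_0_nat by (simp add: Suc_le_eq)
    have "insert (p * q) (B \<union> X) \<in> CS k n"
    proof (rule CS_insert[OF C pos])
      show "p * q \<le> n" using mult_le_of_cubes[OF p(2)] Q(2)[OF q(1)] by blast
      fix r assume r: "prime r" "r dvd p * q"
      then have "r = p \<or> r = q"
        using p(1) Q(2)[OF q(1)] by (metis prime_dvd_mult_iff primes_dvd_imp_eq)
      then show "occ r (B \<union> X) < k" using lt q(3) by auto
    qed
    then have "good (insert (p * q) X)" using X p q(1) by (auto simp: good_def)
    then show False using max q(2) finX by fastforce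
  qed
  have form: "\<exists>p q. prime p \<and> p ^ 3 \<le> n \<and> q \<in> Q \<and> x = p * q" if "x \<in> X" for x
    using X that by (simp add: good_def)
  then have "B \<inter> X = {}"
    using nosmall by (metis disjoint_iff dvd_triv_left)
  then show thesis using that C form full by simp
qed

section \<open>Comparison of the refilled set with a maximal one\<close>

text \<open>If \<open>q \<le> p\<close>, then \<open>q^2 \<le> p^2 \<le> p^3 \<le> n\<close>. Thus
  the large factor of an element of \<open>X\<close> is never a small prime.\<close>

lemma prime_pow_between_gt:
  fixes p q n :: nat
  assumes "p ^ 3 \<le> n" "n < q\<^sup>2"
  shows "p < q"
proof (rule ccontr)
  assume "\<not> p < q"
  then have "q\<^sup>2 \<le> p\<^sup>2" by (simp add: power_mono)
  moreover have "p\<^sup>2 \<le> p ^ 3" by (cases "p = 0") (auto intro: power_increasing)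
  ultimately show False using assms by linarith
qed

text \<open>Maximality survives because at most \<open>k\<close> elements per small prime are
  discarded, while \<open>X\<close> supplies exactly \<open>k\<close> multiples of each, and no
  element of \<open>X\<close> is counted for two small primes.\<close>

lemma ex_CS_max_form:
  assumes k: "k \<ge> 2" and n: "n \<ge> 1"
    and Q: "finite Q" "\<And>q. q \<in> Q \<Longrightarrow> prime q \<and> n < q\<^sup>2 \<and> q ^ 3 \<le> n\<^sup>2"
    and card: "k * card {p. prime p \<and> p\<^sup>2 \<le> n} + k * (k - 1) < (k - 1) * card Q"
  obtains B X where "B \<union> X \<in> CS_max k n" "core n \<subseteq> B"
    "\<And>b p. b \<in> B \<Longrightarrow> prime p \<Longrightarrow> p ^ 3 \<le> n \<Longrightarrow> \<not> p dvd b"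
    "\<And>x. x \<in> X \<Longrightarrow> \<exists>p q. prime p \<and> p ^ 3 \<le> n \<and> q \<in> Q \<and> x = p * q"
    "\<And>p. prime p \<Longrightarrow> p ^ 3 \<le> n \<Longrightarrow> occ p X = k"
proof -
  obtain A where A: "A \<in> CS_max k n" "core n \<subseteq> A"
    using ex_CS_max_core[OF k n] by blast
  have ACS: "A \<in> CS k n" and max: "\<And>B. B \<in> CS k n \<Longrightarrow> card B \<le> card A"
    using A(1) by (auto simp: CS_max_def)
  define S where "S = {p. prime p \<and> p ^ 3 \<le> n}"
  define R where "R = {a \<in> A. \<exists>p\<in>S. p dvd a}"
  define B where "B = A - R"
  have finS: "finite S" by (simp add: S_def finite_prime_power_le)
  have BCS: "B \<in> CS k n" using CS_mono[OF ACS] by (auto simp: B_def)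
  have nosmall: "\<not> p dvd b" if "b \<in> B" "prime p" "p ^ 3 \<le> n" for b p
    using that by (auto simp: B_def R_def S_def)
  have coreB: "core n \<subseteq> B"
  proof
    fix g assume g: "g \<in> core n"
    have "\<not> p dvd g" if "p \<in> S" for p
      using core_dvd(1)[OF g, of p] that by (auto simp: S_def)
    then show "g \<in> B" using g A(2) by (auto simp: B_def R_def)
  qed
  obtain X where X: "B \<union> X \<in> CS k n" "B \<inter> X = {}"
    "\<And>x. x \<in> X \<Longrightarrow> \<exists>p q. prime p \<and> p ^ 3 \<le> n \<and> q \<in> Q \<and> x = p * q"
    "\<And>p. prime p \<Longrightarrow> p ^ 3 \<le> n \<Longrightarrow> occ p X = k"
    by (rule ex_refill[OF BCS nosmall Q card]) blast+
  have fin: "finite B" "finite X" "finite A"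
    using CS_finite[OF X(1)] CS_finite[OF ACS] by auto
  have "card R \<le> k * card S"
    unfolding R_def by (rule card_small_multiples_le[OF ACS finS]) (simp add: S_def)
  also have "\<dots> = (\<Sum>p\<in>S. occ p X)"
    using X(4) by (simp add: S_def mult.commute)
  also have "\<dots> = card (\<Union>p\<in>S. X \<inter> {m. p dvd m})"
    unfolding occ_def
  proof (rule card_UN_disjoint[symmetric, OF finS])
    show "\<forall>p\<in>S. finite (X \<inter> {m. p dvd m})" using fin by simp
    show "\<forall>p\<in>S. \<forall>r\<in>S. p \<noteq> r \<longrightarrow> X \<inter> {m. p dvd m} \<inter> (X \<inter> {m. r dvd m}) = {}"
    proof (intro ballI impI)
      fix p r assume pr: "p \<in> S" "r \<in> S" "p \<noteq> r"
      have "\<not> (p dvd x \<and> r dvd x)" if x: "x \<in> X" for x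
      proof -
        obtain u q where u: "prime u" "u ^ 3 \<le> n" "q \<in> Q" "x = u * q" using X(3)[OF x] by blast
        \<comment> \<open>A small prime \<open>t\<close> is less than \<open>q\<close>, so it can
          divide \<open>u * q\<close> only by being \<open>u\<close>.\<close>
        have "t = u" if t: "t \<in> S" "t dvd x" for t
        proof -
          have "t < q" using prime_pow_between_gt t Q(2)[OF u(3)] by (auto simp: S_def)
          then show ?thesis
            using t u Q(2)[OF u(3)] unfolding S_def
            by (metis mem_Collect_eq nless_le prime_dvd_mult_iff primes_dvd_imp_eq)
        qed
        then show ?thesis using pr by blast
      qed
      then show "X \<inter> {m. p dvd m} \<inter> (X \<inter> {m. r dvd m}) = {}" by blast
    qed
  qed
  also have "\<dots> \<le> card X"
    by (rule card_mono) (use fin in auto)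
  finally have "card R \<le> card X" .
  moreover have "card A = card B + card R"
    using fin by (subst card_Un_disjoint[symmetric]) (auto simp: B_def R_def intro: arg_cong[where f = card])
  ultimately have "card A \<le> card (B \<union> X)"
    using card_Un_disjoint[OF fin(1,2) X(2)] by simp
  then have "B \<union> X \<in> CS_max k n"
    using X(1) max unfolding CS_max_def by (blast intro: order_trans)
  then show thesis using that coreB nosmall X(3,4) by simp
qed

section \<open>Translation to real roots and conclusion\<close>

lemma le_root_iff: "real p \<le> root 3 (real n) \<longleftrightarrow> p ^ 3 \<le> n"
proof -
  have "real p \<le> root 3 (real n) \<longleftrightarrow> root 3 (real p ^ 3) \<le> root 3 (real n)"
    by (simp add: real_root_power_cancel)
  also have "\<dots> \<longleftrightarrow> real (p ^ 3) \<le> real n" by simp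
  finally show ?thesis by (simp only: of_nat_le_iff)
qed

lemma le_sqrt_iff: "real p \<le> sqrt (real n) \<longleftrightarrow> p\<^sup>2 \<le> n"
proof -
  have "real p \<le> sqrt (real n) \<longleftrightarrow> sqrt (real p ^ 2) \<le> sqrt (real n)"
    by (simp add: real_sqrt_abs)
  also have "\<dots> \<longleftrightarrow> real (p\<^sup>2) \<le> real n"
    unfolding real_sqrt_le_iff by simp
  finally show ?thesis by (simp only: of_nat_le_iff)
qed

lemma
  shows primes_between_small: "primes_between 1 (root 3 (real n)) = {p. prime p \<and> p ^ 3 \<le> n}"
    and primes_between_medium:
      "primes_between (root 3 (real n)) (sqrt (real n)) = {p. prime p \<and> n < p ^ 3 \<and> p\<^sup>2 \<le> n}"
    and primes_between_large: "primes_between (sqrt (real n)) (real n) = {p. prime p \<and> n < p\<^sup>2 \<and> p \<le> n}"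
    and primes_between_nonsmall: "primes_between (root 3 (real n)) (real n) = {p. prime p \<and> n < p ^ 3 \<and> p \<le> n}"
  unfolding primes_between_def
  by (auto simp: le_root_iff le_sqrt_iff not_le[symmetric] dest: prime_gt_1_nat)

theorem theorem2:
  fixes k n :: nat
  assumes "k \<ge> 4" and "n \<ge> 1"
    and "(int k - 1) * int (prime_pi (root 3 (real n ^ 2)))
           - (2 * int k - 1) * int (prime_pi (sqrt (real n))) > int k ^ 2 - int k"
  shows "\<exists>A \<in> CS_max k n. \<exists>X Y Z.
    A = {1} \<union> primes_between (root 3 (real n)) (real n)
          \<union> {p ^ 2 | p. p \<in> primes_between (root 3 (real n)) (sqrt (real n))}
          \<union> X \<union> Y \<union> Z
    \<and> (\<forall>p \<in> primes_between 1 (root 3 (real n)). occ p X = k)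
    \<and> (\<forall>x \<in> X. \<exists>p \<in> primes_between 1 (root 3 (real n)).
          \<exists>q \<in> primes_between (sqrt (real n)) (real n). x = p * q)
    \<and> (\<forall>y \<in> Y. \<exists>p \<in> primes_between (root 3 (real n)) (sqrt (real n)).
          \<exists>q \<in> primes_between (sqrt (real n)) (real n). y = p * q)
    \<and> (\<forall>z \<in> Z. \<exists>p \<in> primes_between (root 3 (real n)) (sqrt (real n)).
          \<exists>q \<in> primes_between (root 3 (real n)) (sqrt (real n)). p \<noteq> q \<and> z = p * q)"
proof -
  define P where "P = {p. prime p \<and> p\<^sup>2 \<le> n}"
  define P' where "P' = {p. prime p \<and> p ^ 3 \<le> n\<^sup>2}"
  \<comment> \<open>The primes above the square root of \<open>n\<close> and at most
    \<open>n\<close> to the power 2/3.\<close>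
  define Q where "Q = P' - P"
  have fin: "finite P" "finite P'"
    by (simp_all add: P_def P'_def finite_prime_power_le)
  have "prime_pi (sqrt (real n)) = card P"
    by (simp add: prime_pi_def P_def le_sqrt_iff)
  moreover have "prime_pi (root 3 (real n ^ 2)) = card P'"
    using le_root_iff[of _ "n\<^sup>2"] by (simp add: prime_pi_def P'_def)
  ultimately have h: "(int k - 1) * int (card P') - (2 * int k - 1) * int (card P) > int k ^ 2 - int k"
    using assms(3) by simp
  have "int (card P') \<le> int (card P) + int (card Q)"
    using card_Diff_subset_Int[of P' P] card_mono[of P "P' \<inter> P"] fin by (simp add: Q_def)
  then have "(int k - 1) * int (card P') \<le> (int k - 1) * (int (card P) + int (card Q))"
    using assms(1) by (intro mult_left_mono) auto
  \<comment> \<open>Splitting \<open>2 * k - 1\<close> as \<open>(k - 1) + k\<close>: the first part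
    pays for passing from \<open>P'\<close> to \<open>Q\<close>, the second is the coefficient of
    \<open>card P\<close> needed for refilling.\<close>
  then have "int k * int (card P) + int k * (int k - 1) < (int k - 1) * int (card Q)"
    using h by (simp add: algebra_simps power2_eq_square)
  then have "int (k * card P + k * (k - 1)) < int ((k - 1) * card Q)"
    using assms(1) by (simp add: of_nat_diff)
  then have card: "k * card {p. prime p \<and> p\<^sup>2 \<le> n} + k * (k - 1) < (k - 1) * card Q"
    unfolding P_def by (simp only: of_nat_less_iff)
  have Q: "prime q \<and> n < q\<^sup>2 \<and> q ^ 3 \<le> n\<^sup>2" if "q \<in> Q" for q
    using that by (auto simp: Q_def P_def P'_def)
  have Qn: "q \<le> n" if "q \<in> Q" for q
    using mult_le_of_cubes[of 1 n q] Q[OF that] assms(2) by simp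
  have "k \<ge> 2" "finite Q" using assms(1) fin by (simp_all add: Q_def)
  obtain B X where BX: "B \<union> X \<in> CS_max k n" "core n \<subseteq> B"
    and nosmall: "\<And>b p. b \<in> B \<Longrightarrow> prime p \<Longrightarrow> p ^ 3 \<le> n \<Longrightarrow> \<not> p dvd b"
    and X: "\<And>x. x \<in> X \<Longrightarrow> \<exists>p q. prime p \<and> p ^ 3 \<le> n \<and> q \<in> Q \<and> x = p * q"
      "\<And>p. prime p \<Longrightarrow> p ^ 3 \<le> n \<Longrightarrow> occ p X = k"
    by (rule ex_CS_max_form[OF \<open>k \<ge> 2\<close> assms(2) \<open>finite Q\<close> Q card]) blast+
  define M where "M = {p. prime p \<and> n < p ^ 3 \<and> p\<^sup>2 \<le> n}"
  define L where "L = {q. prime q \<and> n < q\<^sup>2 \<and> q \<le> n}"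
  \<comment> \<open>Intersecting with \<open>B\<close> makes the final decomposition an equality
    instead of a mere covering.\<close>
  define Y where "Y = B \<inter> {p * q | p q. p \<in> M \<and> q \<in> L}"
  define Z where "Z = B \<inter> {p * q | p q. p \<in> M \<and> q \<in> M \<and> p \<noteq> q}"
  have "b \<in> core n \<union> Y \<union> Z" if b: "b \<in> B" for b
  proof -
    have bn: "1 \<le> b" "b \<le> n" using BX(1) b CS_subset[of "B \<union> X" k n] by (auto simp: CS_max_def)
    have big: "n < p ^ 3" if "prime p" "p dvd b" for p
      using nosmall[OF b] that by (meson not_le)
    consider "b \<in> core n"
      | p q where "prime p" "prime q" "n < p ^ 3" "n < q ^ 3" "p < q" "p\<^sup>2 \<le> n" "q \<le> n" "b = p * q"
      by (rule no_small_prime_factor_cases[OF bn big]) blast+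
    then show ?thesis
    proof cases
      case (2 p q)
      then have "p \<in> M" by (simp add: M_def)
      \<comment> \<open>The position of \<open>q\<close> relative to the square root of
        \<open>n\<close> decides between \<open>Z\<close> and \<open>Y\<close>; \<open>p < q\<close>
        gives the distinctness required in \<open>Z\<close>.\<close>
      moreover have "q \<in> M \<or> q \<in> L" using 2 by (auto simp: M_def L_def)
      ultimately show ?thesis using 2 b unfolding Y_def Z_def by blast
    qed auto
  qed
  then have "B \<union> X = core n \<union> X \<union> Y \<union> Z"
    using BX(2) by (auto simp: Y_def Z_def)
  also have "core n = {1} \<union> {p. prime p \<and> n < p ^ 3 \<and> p \<le> n} \<union> {p ^ 2 | p. p \<in> M}"
    by (simp add: core_def M_def)
  finally have eq: "B \<union> X = \<dots> \<union> X \<union> Y \<union> Z" .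
  have form: "\<forall>x\<in>X. \<exists>p\<in>{p. prime p \<and> p ^ 3 \<le> n}. \<exists>q\<in>L. x = p * q"
    using X(1) Q Qn unfolding L_def by blast
  show ?thesis
    unfolding primes_between_small primes_between_medium primes_between_large primes_between_nonsmall
      M_def[symmetric] L_def[symmetric]
    by (rule bexI[OF _ BX(1)], intro exI conjI, rule eq)
      (use X(2) form in \<open>auto simp only: Y_def Z_def\<close>)
qed

end
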